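(* Let $A\in\mathbb{R}^{m\times n}$, $b\in\mathbb{R}^m$, and let $P\in\mathbb{R}^{m\times m}$, $Q\in\mathbb{R}^{n\times n}$ be symmetric positive semidefinite. Put $G=A^{\top}PA+Q$, $\mathcal{X}:=(\mathcal{R}(G),\langle\cdot,\cdot\rangle_{G})$, $\mathcal{Y}:=(\mathcal{R}(P),\langle\cdot,\cdot\rangle_{P})$, and let $\mathcal{A}:\mathcal{X}\to\mathcal{Y}$ be the linear operator $\mathcal{A}v=\mathcal{P}_{\mathcal{R}(P)}Av$. Then the minimum $\|\cdot\|_{\mathcal{X}}$-norm solution of the least squares problem $$\min_{v\in\mathcal{X}} \|\mathcal{A} v - \mathcal{P}_{\mathcal{R}(P)}b\|_{\mathcal{Y}}$$ is the unique solution in $\mathcal{R}(G)$ of the generalized least squares problem $$\min_{x\in\mathbb{R}^{n}}\|x\|_{Q}\quad\text{s.t.}\quad \|Ax-b\|_{P}=\min.$$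
   Context: $\mathcal{R}(\cdot)$ denotes range, and $\mathcal{P}_{\mathcal{S}}$ is the (Euclidean) orthogonal projector onto a subspace $\mathcal{S}$. For a symmetric positive semidefinite $C$, $\|x\|_C=(x^{\top}Cx)^{1/2}$ (a seminorm) and $\langle x,x'\rangle_C=x^{\top}Cx'$; restricted to $\mathcal{R}(C)$ the latter is an inner product, so $\mathcal{X}$ and $\mathcal{Y}$ are finite-dimensional Hilbert spaces. A solution of the generalized least squares problem is a vector $x\in\mathbb{R}^n$ that minimizes $\|x\|_Q$ among all minimizers of $x\mapsto\|Ax-b\|_P$ over $\mathbb{R}^n$. The minimum $\|\cdot\|_{\mathcal{X}}$-norm solution of the least squares problem is the minimizer of smallest $\|\cdot\|_{G}$-norm. *)

theory Defs
  imports "HOL-Analysis.Analysis"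
begin

definition sym_psd :: "real^'n^'n \<Rightarrow> bool" where
  "sym_psd C \<longleftrightarrow> transpose C = C \<and> (\<forall>x. 0 \<le> x \<bullet> (C *v x))"

definition matrix_range :: "real^'n^'m \<Rightarrow> (real^'m) set" where
  "matrix_range C = range (\<lambda>x. C *v x)"

(* The Euclidean orthogonal projector onto a subspace S; the lemma orth_proj below
   shows that the definite description is justified. *)
definition orth_proj :: "'a::euclidean_space set \<Rightarrow> 'a \<Rightarrow> 'a" where
  "orth_proj S x = (THE p. p \<in> S \<and> (\<forall>y\<in>S. orthogonal (x - p) y))"

lemma orth_proj:
  assumes "subspace S"
  shows "orth_proj S x \<in> S" and "y \<in> S \<Longrightarrow> orthogonal (x - orth_proj S x) y"
proof -
  have span: "span S = S"
    using assms by (simp add: span_eq_iff)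
  obtain p z where p: "p \<in> S" and z: "\<And>w. w \<in> S \<Longrightarrow> orthogonal z w" and x: "x = p + z"
    using orthogonal_subspace_decomp_exists[of S x] unfolding span by blast
  have "\<exists>!p. p \<in> S \<and> (\<forall>y\<in>S. orthogonal (x - p) y)"
  proof (rule ex1I[of _ p])
    show "p \<in> S \<and> (\<forall>y\<in>S. orthogonal (x - p) y)"
      using p z x by simp
  next
    fix q assume q: "q \<in> S \<and> (\<forall>y\<in>S. orthogonal (x - q) y)"
    have "p - q \<in> S"
      using assms p q by (simp add: subspace_diff)
    then have "(x - q) \<bullet> (p - q) = 0" "z \<bullet> (p - q) = 0"
      using q z by (auto simp: orthogonal_def)
    then have "(p - q) \<bullet> (p - q) = 0"
      using x by (simp add: inner_diff_left inner_add_left)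
    then show "q = p"
      by simp
  qed
  from theI'[OF this, folded orth_proj_def]
  show "orth_proj S x \<in> S" and "y \<in> S \<Longrightarrow> orthogonal (x - orth_proj S x) y"
    by auto
qed

definition wnorm :: "real^'n^'n \<Rightarrow> real^'n \<Rightarrow> real" where
  "wnorm C x = sqrt (x \<bullet> (C *v x))"

(* A space given by a carrier inside an ambient type together with an inner product,
   which is only meaningful on the carrier. *)
record 'a ip_space =
  points :: "'a set"
  ip :: "'a \<Rightarrow> 'a \<Rightarrow> real"

definition ip_norm :: "'a ip_space \<Rightarrow> 'a \<Rightarrow> real" where
  "ip_norm X x = sqrt (ip X x x)"

definition weighted_space :: "real^'n^'n \<Rightarrow> (real^'n) ip_space" where
  "weighted_space C = \<lparr> points = matrix_range C, ip = (\<lambda>x y. x \<bullet> (C *v y)) \<rparr>"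

definition lsq_solution ::
    "'a ip_space \<Rightarrow> 'b::minus ip_space \<Rightarrow> ('a \<Rightarrow> 'b) \<Rightarrow> 'b \<Rightarrow> 'a \<Rightarrow> bool" where
  "lsq_solution X Y T y = is_arg_min (\<lambda>v. ip_norm Y (T v - y)) (\<lambda>v. v \<in> points X)"

definition min_norm_lsq_solution ::
    "'a ip_space \<Rightarrow> 'b::minus ip_space \<Rightarrow> ('a \<Rightarrow> 'b) \<Rightarrow> 'b \<Rightarrow> 'a \<Rightarrow> bool" where
  "min_norm_lsq_solution X Y T y = is_arg_min (ip_norm X) (lsq_solution X Y T y)"

definition gls_solution ::
    "real^'n^'m \<Rightarrow> real^'m \<Rightarrow> real^'m^'m \<Rightarrow> real^'n^'n \<Rightarrow> real^'n \<Rightarrow> bool" where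
  "gls_solution A b P Q =
     is_arg_min (wnorm Q) (is_arg_min (\<lambda>x. wnorm P (A *v x - b)) (\<lambda>x. True))"

end

theory Submission
  imports Defs
begin

text \<open>
  Projecting onto \<open>\<R>(P)\<close> does not change the \<open>P\<close>-seminorm, so the operator least squares
  problem is the minimization of \<open>\<parallel>A v - b\<parallel>\<^sub>P\<close> over \<open>\<R>(G)\<close>. The minimizers over the whole space
  form a coset of \<open>K = ker (P A)\<close>, on which \<open>\<parallel>x\<parallel>\<^sub>G\<^sup>2\<close> and \<open>\<parallel>x\<parallel>\<^sub>Q\<^sup>2\<close> differ by a constant.
  Minimizing \<open>\<parallel>x\<parallel>\<^sub>Q\<close> on this coset determines \<open>x\<close> up to \<open>K \<inter> ker Q = ker G\<close>, the orthogonal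
  complement of \<open>\<R>(G)\<close>, so exactly one solution lies in \<open>\<R>(G)\<close>.
\<close>

lemma sym_psd_inner_commute:
  assumes "sym_psd C"
  shows "x \<bullet> (C *v y) = y \<bullet> (C *v x)"
  using assms by (metis dot_lmul_matrix inner_commute sym_psd_def transpose_matrix_vector)

lemma sym_psd_nonneg: "sym_psd C \<Longrightarrow> 0 \<le> x \<bullet> (C *v x)"
  by (simp add: sym_psd_def)

lemma sym_psd_quadratic_add:
  assumes "sym_psd C"
  shows "(x + y) \<bullet> (C *v (x + y)) = x \<bullet> (C *v x) + 2 * (y \<bullet> (C *v x)) + y \<bullet> (C *v y)"
  using sym_psd_inner_commute[OF assms, of x y]
  by (simp add: matrix_vector_right_distrib inner_add_left inner_add_right)

text \<open>Moving from \<open>x\<close> along \<open>y = C *v x\<close> changes the form by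
  \<open>2 * t * (y \<bullet> y)\<close> to first order in \<open>t\<close>. A form vanishing at
  \<open>x\<close> would turn negative for small negative \<open>t\<close> unless
  \<open>y = 0\<close>.\<close>

lemma sym_psd_quadratic_eq_0_iff:
  assumes "sym_psd C"
  shows "x \<bullet> (C *v x) = 0 \<longleftrightarrow> C *v x = 0"
proof
  assume zero: "x \<bullet> (C *v x) = 0"
  define y where "y = C *v x"
  define q where "q = y \<bullet> (C *v y)"
  \<comment> \<open>The denominator \<open>q + 1\<close> instead of \<open>q\<close> keeps this step
    length meaningful when \<open>q = 0\<close>.\<close>
  define t where "t = - (y \<bullet> y) / (q + 1)"
  have q: "0 \<le> q"
    unfolding q_def by (rule sym_psd_nonneg[OF assms])
  have "0 \<le> (x + t *\<^sub>R y) \<bullet> (C *v (x + t *\<^sub>R y))"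
    by (rule sym_psd_nonneg[OF assms])
  also have "\<dots> = 2 * t * (y \<bullet> y) + t * t * q"
    unfolding sym_psd_quadratic_add[OF assms] zero
    by (simp add: y_def q_def matrix_vector_mult_scaleR)
  also have "\<dots> = - ((y \<bullet> y)\<^sup>2 * (q + 2) / (q + 1)\<^sup>2)"
    using q by (simp add: t_def divide_simps power2_eq_square) (simp add: algebra_simps)
  finally have "(y \<bullet> y)\<^sup>2 * (q + 2) / (q + 1)\<^sup>2 \<le> 0"
    by simp
  then have "y \<bullet> y = 0"
    using q by (auto simp: divide_le_0_iff mult_le_0_iff)
  then show "C *v x = 0"
    by (simp add: y_def)
qed simp

lemma sym_psd_add:
  assumes "sym_psd C" "sym_psd D"
  shows "sym_psd (C + D)"
  using assms
  by (simp add: sym_psd_def transpose_def vec_eq_iff matrix_vector_mult_add_rdistrib inner_add_right)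

lemma inner_congruence_mult:
  fixes A :: "real^'n^'m" and P :: "real^'m^'m"
  shows "u \<bullet> ((transpose A ** P ** A) *v x) = (A *v u) \<bullet> (P *v (A *v x))"
  by (metis dot_lmul_matrix matrix_vector_mul_assoc transpose_matrix_vector transpose_transpose)

lemma sym_psd_congruence:
  fixes A :: "real^'n^'m"
  assumes "sym_psd P"
  shows "sym_psd (transpose A ** P ** A)"
  using assms unfolding sym_psd_def inner_congruence_mult
  by (simp add: matrix_transpose_mul matrix_mul_assoc)

text \<open>Two nonnegative quadratic forms have sum zero only if both are zero, and a zero of
  either form is a kernel vector.\<close>

lemma sym_psd_sum_kernel:
  assumes "sym_psd C" "sym_psd D"
  shows "(C + D) *v x = 0 \<longleftrightarrow> C *v x = 0 \<and> D *v x = 0"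
  using sym_psd_nonneg[OF assms(1), of x] sym_psd_nonneg[OF assms(2), of x]
  unfolding sym_psd_quadratic_eq_0_iff[OF assms(1), symmetric]
    sym_psd_quadratic_eq_0_iff[OF assms(2), symmetric]
    sym_psd_quadratic_eq_0_iff[OF sym_psd_add[OF assms], symmetric]
  by (simp add: matrix_vector_mult_add_rdistrib inner_add_right add_nonneg_eq_0_iff)

lemma sym_psd_congruence_kernel:
  fixes A :: "real^'n^'m"
  assumes "sym_psd P"
  shows "(transpose A ** P ** A) *v x = 0 \<longleftrightarrow> P *v (A *v x) = 0"
  using sym_psd_quadratic_eq_0_iff[OF sym_psd_congruence[OF assms], of x A]
    sym_psd_quadratic_eq_0_iff[OF assms, of "A *v x"]
  by (simp add: inner_congruence_mult)

lemma subspace_matrix_range: "subspace (matrix_range C)"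
  unfolding matrix_range_def by (intro linear_subspace_image) auto

text \<open>The residual \<open>z\<close> is orthogonal to the whole range, in particular to
  \<open>C *v z\<close>, so the form vanishes at \<open>z\<close>.\<close>

lemma mult_orth_proj_matrix_range:
  assumes "sym_psd C"
  shows "C *v orth_proj (matrix_range C) x = C *v x"
proof -
  define z where "z = x - orth_proj (matrix_range C) x"
  have "z \<bullet> (C *v z) = 0"
    using orth_proj(2)[OF subspace_matrix_range, of "C *v z" C x]
    by (simp add: z_def matrix_range_def orthogonal_def)
  then have "C *v z = 0"
    by (simp add: sym_psd_quadratic_eq_0_iff assms)
  then show ?thesis
    by (simp add: z_def matrix_vector_mult_diff_distrib)
qed

text \<open>By symmetry the range is orthogonal to the kernel.\<close>

lemma matrix_range_kernel_trivial:
  assumes "sym_psd C" "x \<in> matrix_range C" "C *v x = 0"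
  shows "x = 0"
proof -
  obtain w where "x = C *v w"
    using assms(2) by (auto simp: matrix_range_def)
  then have "x \<bullet> x = w \<bullet> (C *v x)"
    using sym_psd_inner_commute[OF assms(1), of x w] by simp
  then show ?thesis
    using assms(3) by simp
qed

text \<open>Projection of \<open>a\<close> onto \<open>S\<close> for the possibly degenerate form of
  \<open>C\<close>. The claim amounts to \<open>C *v a\<close> lying in \<open>W\<close>, the sum of
  the image of \<open>S\<close> under \<open>C\<close> and the orthogonal complement of
  \<open>S\<close>; the proof shows that its component \<open>z\<close> orthogonal to
  \<open>W\<close> is zero.\<close>

lemma sym_psd_projection_exists:
  assumes C: "sym_psd C" and S: "subspace S"
  shows "\<exists>s\<in>S. \<forall>u\<in>S. u \<bullet> (C *v (a - s)) = 0"
proof -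
  define W where "W = {x + y |x y. x \<in> (*v) C ` S \<and> y \<in> S\<^sup>\<bottom>}"
  have CS: "subspace ((*v) C ` S)"
    using S by (intro linear_subspace_image) auto
  have W: "subspace W"
    unfolding W_def by (rule subspace_sums[OF CS subspace_orthogonal_comp])
  obtain p z where p: "p \<in> span W" and z: "\<And>w. w \<in> span W \<Longrightarrow> orthogonal z w"
    and eq: "C *v a = p + z"
    using orthogonal_subspace_decomp_exists[of W "C *v a"] by blast
  have spanW: "span W = W"
    using W by (simp add: span_eq_iff)
  have "z \<in> (S\<^sup>\<bottom>)\<^sup>\<bottom>"
  proof -
    have "orthogonal z y" if "y \<in> S\<^sup>\<bottom>" for y
    proof -
      have "0 + y \<in> W"
        unfolding W_def using that subspace_0[OF CS] by blast
      then show ?thesis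
        using z spanW by simp
    qed
    then show ?thesis
      by (simp add: orthogonal_comp_def orthogonal_commute)
  qed
  then have "z \<in> S"
    by (simp add: orthogonal_comp_self S)
  \<comment> \<open>As \<open>z\<close> lies in \<open>S\<close>, its image lies in \<open>W\<close>
    and is thus orthogonal to \<open>z\<close>, which forces \<open>C *v z = 0\<close>.\<close>
  then have "C *v z + 0 \<in> W"
    unfolding W_def using subspace_0[OF subspace_orthogonal_comp] by blast
  then have "z \<bullet> (C *v z) = 0"
    using z spanW by (simp add: orthogonal_def)
  then have "C *v z = 0"
    by (simp add: sym_psd_quadratic_eq_0_iff C)
  then have "z \<bullet> (C *v a) = 0"
    using sym_psd_inner_commute[OF C, of z a] by simp
  moreover have "z \<bullet> p = 0"
    using z p by (simp add: orthogonal_def)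
  ultimately have "z = 0"
    using eq by (simp add: inner_add_right)
  then have "C *v a \<in> W"
    using eq p spanW by simp
  then obtain s y where s: "s \<in> S" and y: "y \<in> S\<^sup>\<bottom>" and a: "C *v a = C *v s + y"
    unfolding W_def by blast
  have "u \<bullet> (C *v (a - s)) = 0" if "u \<in> S" for u
    using y that a by (simp add: orthogonal_comp_def orthogonal_def matrix_vector_mult_diff_distrib)
  with s show ?thesis
    by blast
qed

text \<open>Pythagoras: the form at \<open>h x\<close> is its value at \<open>h z\<close> plus its
  value at \<open>h x - h z\<close>. With \<open>R\<close> and \<open>h\<close> arbitrary, this
  serves both the residual and the norm minimizations.\<close>

lemma is_arg_min_wnorm_iff:
  assumes C: "sym_psd C" and R: "R z"
    and orth: "\<And>x. R x \<Longrightarrow> (h x - h z) \<bullet> (C *v h z) = 0"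
  shows "is_arg_min (\<lambda>x. wnorm C (h x)) R x \<longleftrightarrow> R x \<and> C *v (h x - h z) = 0"
proof -
  define q where "q y = y \<bullet> (C *v y)" for y
  have q: "q (h x) = q (h z) + q (h x - h z)" if "R x" for x
    using sym_psd_quadratic_add[OF C, of "h z" "h x - h z"] orth[OF that] by (simp add: q_def)
  have nonneg: "0 \<le> q y" for y
    by (simp add: q_def sym_psd_nonneg C)
  have less: "wnorm C u < wnorm C v \<longleftrightarrow> q u < q v" for u v
    by (simp add: wnorm_def q_def)
  have "is_arg_min (\<lambda>x. wnorm C (h x)) R x \<longleftrightarrow> R x \<and> q (h x - h z) = 0"
  proof
    assume min: "is_arg_min (\<lambda>x. wnorm C (h x)) R x"
    then have "R x" "\<not> q (h z) < q (h x)"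
      using R by (auto simp: is_arg_min_def less)
    then show "R x \<and> q (h x - h z) = 0"
      using q[of x] nonneg[of "h x - h z"] by simp
  next
    assume x: "R x \<and> q (h x - h z) = 0"
    have "\<not> q (h y) < q (h x)" if "R y" for y
      using q[of x] q[OF that] nonneg[of "h y - h z"] x by simp
    then show "is_arg_min (\<lambda>x. wnorm C (h x)) R x"
      using x by (auto simp: is_arg_min_def less)
  qed
  then show ?thesis
    by (simp add: q_def sym_psd_quadratic_eq_0_iff C)
qed

theorem theorem3p4:
  fixes A :: "real^'n^'m" and b :: "real^'m"
    and P :: "real^'m^'m" and Q :: "real^'n^'n"
  assumes "sym_psd P" and "sym_psd Q"
  defines "G \<equiv> transpose A ** P ** A + Q"
  defines "X \<equiv> weighted_space G"
    and "Y \<equiv> weighted_space P"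
    and "T \<equiv> (\<lambda>v. orth_proj (matrix_range P) (A *v v))"
  shows "\<exists>x. (\<forall>v. min_norm_lsq_solution X Y T (orth_proj (matrix_range P) b) v \<longleftrightarrow> v = x)
           \<and> (\<forall>v. v \<in> matrix_range G \<and> gls_solution A b P Q v \<longleftrightarrow> v = x)"
proof -
  note P = assms(1) and Q = assms(2)
  have G: "sym_psd G"
    unfolding G_def by (intro sym_psd_add sym_psd_congruence P Q)
  have inner_G: "u \<bullet> (G *v x) = (A *v u) \<bullet> (P *v (A *v x)) + u \<bullet> (Q *v x)" for u x
    by (simp add: G_def matrix_vector_mult_add_rdistrib inner_add_right inner_congruence_mult)
  have ker_G: "G *v x = 0 \<longleftrightarrow> P *v (A *v x) = 0 \<and> Q *v x = 0" for x
    unfolding G_def by (simp add: sym_psd_sum_kernel sym_psd_congruence_kernel sym_psd_congruence P Q)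
  define K where "K = {k. P *v (A *v k) = 0}"
  have K: "subspace K"
    by (auto simp: K_def subspace_def matrix_vector_right_distrib matrix_vector_mult_scaleR)

  \<comment> \<open>Normal equations: \<open>A *v x0\<close> is a \<open>P\<close>-orthogonal
    projection of \<open>b\<close> onto the range of \<open>A\<close>.\<close>
  obtain x0 where x0: "\<And>u. (A *v u) \<bullet> (P *v (b - A *v x0)) = 0"
    using sym_psd_projection_exists[OF P subspace_matrix_range[of A], of b]
    by (auto simp: matrix_range_def)
  \<comment> \<open>Subtracting a \<open>Q\<close>-projection onto \<open>K\<close> preserves
    \<open>P *v (A *v x0)\<close> and makes the result \<open>Q\<close>-orthogonal to
    \<open>K\<close>.\<close>
  obtain k where k: "k \<in> K" and orth_k: "\<And>u. u \<in> K \<Longrightarrow> u \<bullet> (Q *v (x0 - k)) = 0"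
    using sym_psd_projection_exists[OF Q K, of x0] by blast
  \<comment> \<open>Projecting onto the range of \<open>G\<close> moves the point only along the
    kernel of \<open>G\<close>, where \<open>P *v (A *v _)\<close> and \<open>Q *v _\<close> both
    vanish, so both optimality conditions survive.\<close>
  define x where "x = orth_proj (matrix_range G) (x0 - k)"
  have range_x: "x \<in> matrix_range G"
    unfolding x_def by (rule orth_proj(1)[OF subspace_matrix_range])
  have "G *v (x - (x0 - k)) = 0"
    unfolding matrix_vector_mult_diff_distrib[of G x]
    by (simp add: x_def mult_orth_proj_matrix_range[OF G])
  then have "P *v (A *v (x - (x0 - k))) = 0" and "Q *v (x - (x0 - k)) = 0"
    by (simp_all only: ker_G)
  with k have PAx: "P *v (A *v x) = P *v (A *v x0)" and Qx: "Q *v x = Q *v (x0 - k)"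
    by (simp_all add: K_def matrix_vector_mult_diff_distrib)
  have orth_P: "(A *v u) \<bullet> (P *v (A *v x - b)) = 0" for u
    using x0[of u] by (simp add: matrix_vector_mult_diff_distrib PAx inner_diff_right)
  have orth_Q: "u \<bullet> (Q *v x) = 0" if "u \<in> K" for u
    using orth_k[OF that] by (simp add: Qx)
  \<comment> \<open>On \<open>K\<close> the \<open>A\<close>-part of \<open>G\<close> contributes
    nothing, so the same \<open>x\<close> is optimal for both seminorms.\<close>
  have orth_G: "u \<bullet> (G *v x) = 0" if "u \<in> K" for u
  proof -
    have "(A *v u) \<bullet> (P *v (A *v x)) = (A *v x) \<bullet> (P *v (A *v u))"
      by (rule sym_psd_inner_commute[OF P])
    then show ?thesis
      using that orth_Q[OF that] by (simp add: inner_G K_def)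
  qed

  have diff: "(A *v v - b) - (A *v x - b) = A *v (v - x)" for v
    by (simp add: matrix_vector_mult_diff_distrib)
  \<comment> \<open>The constraint \<open>R\<close> stays open: it becomes membership in the range
    of \<open>G\<close> for the operator problem and \<open>True\<close> for the generalized
    one.\<close>
  have arg_min_P: "is_arg_min (\<lambda>v. wnorm P (A *v v - b)) R v \<longleftrightarrow> R v \<and> v - x \<in> K"
    if "R x" for R v
    using is_arg_min_wnorm_iff[where h = "\<lambda>v. A *v v - b" and R = R, OF P that] orth_P
    unfolding diff K_def by simp

  have norm_PA: "ip_norm Y (T v - orth_proj (matrix_range P) b) = wnorm P (A *v v - b)" for v
  proof -
    define p where "p = T v - orth_proj (matrix_range P) b"
    define r where "r = A *v v - b"
    have eq: "P *v p = P *v r"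
      by (simp add: p_def r_def T_def matrix_vector_mult_diff_distrib mult_orth_proj_matrix_range[OF P])
    \<comment> \<open>By symmetry the quadratic form depends on a vector only through its image
      under \<open>P\<close>.\<close>
    then have "p \<bullet> (P *v p) = r \<bullet> (P *v r)"
      using sym_psd_inner_commute[OF P, of p r] by simp
    then show ?thesis
      by (simp add: ip_norm_def Y_def weighted_space_def wnorm_def p_def r_def)
  qed
  have lsq: "lsq_solution X Y T (orth_proj (matrix_range P) b) =
      (\<lambda>v. v \<in> matrix_range G \<and> v - x \<in> K)"
    unfolding lsq_solution_def norm_PA
    using arg_min_P[where R = "\<lambda>v. v \<in> matrix_range G"] range_x
    by (simp add: fun_eq_iff X_def weighted_space_def)
  have unique: "v \<in> matrix_range G \<and> G *v (v - x) = 0 \<longleftrightarrow> v = x" for v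
    using matrix_range_kernel_trivial[OF G subspace_diff[OF subspace_matrix_range _ range_x], of v]
      range_x by auto

  have ip_norm_X: "ip_norm X = wnorm G"
    by (simp add: fun_eq_iff ip_norm_def X_def weighted_space_def wnorm_def)
  have "min_norm_lsq_solution X Y T (orth_proj (matrix_range P) b) v \<longleftrightarrow>
      (v \<in> matrix_range G \<and> v - x \<in> K) \<and> G *v (v - x) = 0" for v
    unfolding min_norm_lsq_solution_def lsq ip_norm_X
    by (rule is_arg_min_wnorm_iff[where h = "\<lambda>v. v", OF G])
      (simp_all add: range_x orth_G subspace_0[OF K])
  then have min_norm: "min_norm_lsq_solution X Y T (orth_proj (matrix_range P) b) v \<longleftrightarrow> v = x" for v
    using unique[of v] ker_G[of "v - x"] unfolding K_def by blast

  have gls: "is_arg_min (\<lambda>x. wnorm P (A *v x - b)) (\<lambda>x. True) = (\<lambda>v. v - x \<in> K)"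
    using arg_min_P[where R = "\<lambda>v. True"] by (simp add: fun_eq_iff)
  have "gls_solution A b P Q v \<longleftrightarrow> v - x \<in> K \<and> Q *v (v - x) = 0" for v
    unfolding gls_solution_def gls
    by (rule is_arg_min_wnorm_iff[where h = "\<lambda>v. v", OF Q])
      (simp_all add: orth_Q subspace_0[OF K])
  then have "v \<in> matrix_range G \<and> gls_solution A b P Q v \<longleftrightarrow> v = x" for v
    using unique[of v] ker_G[of "v - x"] unfolding K_def by blast
  with min_norm show ?thesis
    by blast
qed

end
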